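(* Let $k\geq 3$ and $n$ be positive integers and let $a_1<a_2<\cdots<a_k$ be positive integers satisfying $\frac{n}{2^{n}}=\sum_{i=1}^{k}\frac{a_{i}}{2^{a_{i}}}$. Then for every $i$ with $1\leq i\leq k-2$, $$2^{a_k-a_i}\leq \left(a_{i+2}\cdot a_{i+3}\cdots a_{k-1}\cdot a_k\right)\cdot a_k .$$
   Context: The equation $\frac{n}{2^{n}}=\sum_{i=1}^{k}\frac{a_{i}}{2^{a_{i}}}$ is considered in positive integers $n,k,a_1,\ldots,a_k$ with $k\geq 2$ and $a_1<\cdots<a_k$. *)

theory Defs
  imports Complex_Main
begin

end

theory Submission
  imports Defs
begin

text \<open>
  Multiplying the equation by \<open>2 ^ a i\<close> shows that \<open>2 ^ a i\<close> times the tail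
  \<open>(\<Sum>j>i. a j / 2 ^ a j)\<close> is an integer (as \<open>n < a 1\<close>); it is positive, hence at least 1. So
  \<open>2 ^ (a k - a i) \<le> U i\<close> for \<open>U i = (\<Sum>j>i. a j * 2 ^ (a k - a j))\<close>, and
  \<open>U i = a (i+1) * 2 ^ (a k - a (i+1)) + U (i+1) \<le> (a (i+1) + 1) * U (i+1) \<le> a (i+2) * U (i+1)\<close>.
  Since \<open>U (k-1) = a k\<close>, descending induction bounds \<open>U i\<close> by the right-hand side.
\<close>

text \<open>Each step holds because \<open>n + 1 \<le> 2 * n\<close> for \<open>n \<ge> 1\<close>.
  The values at 1 and 2 coincide, so the inequality cannot be made strict.\<close>

lemma of_nat_div_pow2_antimono:
  fixes m n :: nat
  assumes "0 < m" "m \<le> n"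
  shows "real n / 2 ^ n \<le> real m / 2 ^ m"
  using assms(2,1)
proof (induction rule: dec_induct)
  case (step n)
  then have "real (Suc n) \<le> 2 * real n" by simp
  then have "real (Suc n) / 2 ^ Suc n \<le> real n / 2 ^ n" by (simp add: field_simps)
  with step show ?case by simp
qed simp

lemma pow2_mult_div_pow2_in_Ints:
  assumes "p \<le> q"
  shows "2 ^ q * (real m / 2 ^ p) \<in> \<int>"
proof -
  have "2 ^ q * (real m / 2 ^ p) = real (2 ^ (q - p) * m)"
    using assms by (simp add: field_simps flip: power_add)
  then show ?thesis by (metis Ints_of_nat)
qed

text \<open>Serves twice: at \<open>i\<close> itself for the final bound, and at every later index
  in the descending induction.\<close>

lemma one_le_pow2_mult_tail:
  fixes n k i :: nat and a :: "nat \<Rightarrow> nat"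
  assumes pos: "\<And>i. i \<in> {1..k} \<Longrightarrow> a i > 0"
    and mono: "strict_mono_on {1..k} a"
    and eq: "real n / 2 ^ n = (\<Sum>i = 1..k. real (a i) / 2 ^ a i)"
    and i: "1 \<le> i" "i < k"
  shows "1 \<le> 2 ^ a i * (\<Sum>j = Suc i..k. real (a j) / 2 ^ a j)"
proof -
  let ?f = "\<lambda>j. real (a j) / 2 ^ a j"
  have tail_pos: "(\<Sum>j = Suc m..k. ?f j) > 0" if "m < k" for m
    using that pos by (intro sum_pos) auto
  have mono_le: "a j \<le> a l" if "1 \<le> j" "j \<le> l" "l \<le> k" for j l
    using strict_mono_on_leD[OF mono, of j l] that by simp
  \<comment> \<open>Otherwise the first summand alone is at least \<open>n / 2 ^ n\<close>, and the
    remaining positive summands break the equation.\<close>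
  have "n < a 1"
  proof (rule ccontr)
    assume "\<not> n < a 1"
    then have "real n / 2 ^ n \<le> ?f 1"
      using pos i by (intro of_nat_div_pow2_antimono) auto
    moreover have "(\<Sum>j = 1..k. ?f j) = ?f 1 + (\<Sum>j = Suc 1..k. ?f j)"
      using i by (intro sum.atLeast_Suc_atMost) auto
    ultimately show False using eq tail_pos[of 1] i by simp
  qed
  then have "n \<le> a i" using mono_le[of 1 i] i by simp
  have "(\<Sum>j = 1..k. ?f j) = (\<Sum>j = 1..i. ?f j) + (\<Sum>j = Suc i..k. ?f j)"
    using sum.ub_add_nat[of 1 i ?f "k - i"] i by simp
  \<comment> \<open>On the right every denominator is \<open>2 ^ n\<close> or \<open>2 ^ a j\<close>
    with \<open>j \<le> i\<close>, hence divides \<open>2 ^ a i\<close>.\<close>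
  then have "2 ^ a i * (\<Sum>j = Suc i..k. ?f j)
      = 2 ^ a i * (real n / 2 ^ n) - (\<Sum>j = 1..i. 2 ^ a i * ?f j)"
    unfolding eq by (simp only: sum_distrib_left[symmetric]) (simp add: algebra_simps)
  also have "\<dots> \<in> \<int>"
    using \<open>n \<le> a i\<close> mono_le i
    by (intro Ints_diff Ints_sum pow2_mult_div_pow2_in_Ints) auto
  finally have "2 ^ a i * (\<Sum>j = Suc i..k. ?f j) \<in> \<int>" .
  then show ?thesis
    using tail_pos[OF i(2)] Ints_nonzero_abs_ge1[of "2 ^ a i * (\<Sum>j = Suc i..k. ?f j)"] by simp
qed

text \<open>The left side is \<open>U i\<close>, written as a scaled tail to keep subtraction out of
  the exponents. The range of \<open>i\<close> reaches \<open>k - 1\<close>, where the product is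
  empty and both sides equal \<open>a k\<close>, so that the induction can start there.\<close>

lemma pow2_mult_tail_le_prod:
  fixes n k i :: nat and a :: "nat \<Rightarrow> nat"
  assumes pos: "\<And>i. i \<in> {1..k} \<Longrightarrow> a i > 0"
    and mono: "strict_mono_on {1..k} a"
    and eq: "real n / 2 ^ n = (\<Sum>i = 1..k. real (a i) / 2 ^ a i)"
    and i: "1 \<le> i" "i \<le> k - 1" and k: "2 \<le> k"
  shows "2 ^ a k * (\<Sum>j = Suc i..k. real (a j) / 2 ^ a j) \<le> real ((\<Prod>j = i + 2..k. a j) * a k)"
  using i(2,1)
proof (induction rule: inc_induct)
  case base
  from k show ?case by simp
next
  case (step m)
  let ?f = "\<lambda>j. real (a j) / 2 ^ a j"
  let ?t = "\<lambda>i. \<Sum>j = Suc i..k. ?f j"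
  have m: "1 \<le> Suc m" "Suc m < k" using step.hyps by auto
  have "?t m = ?f (Suc m) + ?t (Suc m)"
    using m by (intro sum.atLeast_Suc_atMost) auto
  \<comment> \<open>Scaling the lower bound 1 at index \<open>Suc m\<close> by
    \<open>?f (Suc m)\<close> cancels the power of 2.\<close>
  moreover have "?f (Suc m) \<le> real (a (Suc m)) * ?t (Suc m)"
    using mult_left_mono[OF one_le_pow2_mult_tail[OF pos mono eq m], of "?f (Suc m)"]
    by simp
  ultimately have "?t m \<le> (real (a (Suc m)) + 1) * ?t (Suc m)"
    by (simp add: algebra_simps)
  \<comment> \<open>Between integers the strict inequality absorbs the \<open>+ 1\<close>.\<close>
  also have "a (Suc m) < a (m + 2)"
    using strict_mono_onD[OF mono, of "Suc m" "m + 2"] m by simp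
  then have "(real (a (Suc m)) + 1) * ?t (Suc m) \<le> real (a (m + 2)) * ?t (Suc m)"
    by (intro mult_right_mono sum_nonneg) auto
  finally have "2 ^ a k * ?t m \<le> real (a (m + 2)) * (2 ^ a k * ?t (Suc m))"
    by (simp add: mult.left_commute)
  also have "\<dots> \<le> real (a (m + 2)) * real ((\<Prod>j = Suc m + 2..k. a j) * a k)"
    using step.IH by (intro mult_left_mono) auto
  also have "\<dots> = real ((\<Prod>j = m + 2..k. a j) * a k)"
    using m prod.atLeast_Suc_atMost[of "m + 2" k a] by simp
  finally show ?case .
qed

theorem theorem2p3:
  fixes n k :: nat and a :: "nat \<Rightarrow> nat"
  assumes "k \<ge> 3" and "n > 0"
    and "\<And>i. i \<in> {1..k} \<Longrightarrow> a i > 0"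
    and "strict_mono_on {1..k} a"
    and "real n / 2 ^ n = (\<Sum>i = 1..k. real (a i) / 2 ^ a i)"
  shows "\<forall>i \<in> {1..k - 2}. 2 ^ (a k - a i) \<le> (\<Prod>j = i + 2..k. a j) * a k"
proof
  fix i assume i: "i \<in> {1..k - 2}"
  let ?t = "\<Sum>j = Suc i..k. real (a j) / 2 ^ a j"
  \<comment> \<open>Makes the truncated subtraction \<open>a k - a i\<close> exact, so that
    \<open>2 ^ a k\<close> splits.\<close>
  have "a i \<le> a k"
    using strict_mono_on_leD[OF assms(4), of i k] i by auto
  then have "(2::real) ^ (a k - a i) * (2 ^ a i * ?t) = 2 ^ a k * ?t"
    by (simp flip: mult.assoc power_add)
  moreover have "1 \<le> 2 ^ a i * ?t"
    using i assms(1) by (intro one_le_pow2_mult_tail[OF assms(3-5)]) auto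
  then have "(2::real) ^ (a k - a i) * 1 \<le> 2 ^ (a k - a i) * (2 ^ a i * ?t)"
    by (intro mult_left_mono) auto
  moreover have "2 ^ a k * ?t \<le> real ((\<Prod>j = i + 2..k. a j) * a k)"
    using i assms(1) by (intro pow2_mult_tail_le_prod[OF assms(3-5)]) auto
  ultimately have "real (2 ^ (a k - a i)) \<le> real ((\<Prod>j = i + 2..k. a j) * a k)"
    unfolding of_nat_power of_nat_numeral by linarith
  then show "2 ^ (a k - a i) \<le> (\<Prod>j = i + 2..k. a j) * a k"
    by (simp only: of_nat_le_iff)
qed

end
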